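(* Let $\Omega_{\rm ref}=[-1,1]$, and let $\pi_h:L^2\Lambda^1(\Omega_{\rm ref})\to\Lambda^1_h$ be the projection of $1$-forms by edge polynomials. Then $\pi_h$ is bounded: there is a constant $C$, independent of $b^{(1)}$, such that for all $b^{(1)}\in L^2\Lambda^1(\Omega_{\rm ref})$ $$\|\pi_hb^{(1)}\|_{L^2\Lambda^1}\le C\,\|b^{(1)}\|_{L^2\Lambda^1}.$$
   Context: $L^2\Lambda^1(\Omega_{\rm ref})$ is the space of $1$-forms $f(\xi)\,\mathrm d\xi$ with $f\in L^2(-1,1)$, with the $L^2$ norm. $H\Lambda^0(\Omega_{\rm ref})=\{a\in L^2\Lambda^0:\mathrm da\in L^2\Lambda^1\}$, with $\|a\|^2_{H\Lambda^0}=\|a\|^2_{L^2\Lambda^0}+\|\mathrm da\|^2_{L^2\Lambda^1}$ and semi-norm $|a|_{H\Lambda^0}=\|\mathrm da\|_{L^2\Lambda^1}$. Given nodes $-1\le\xi_0<\dots<\xi_N\le1$ with Lagrange polynomials $l_i$ of degree $N$ ($l_i(\xi_p)=\delta_{ip}$), the projection of $0$-forms is $\pi_ha^{(0)}=\sum_{i=0}^Na^{(0)}(\xi_i)\,l_i$. The edge polynomials are the $1$-forms $e_i=-\sum_{k=0}^{i-1}\mathrm dl_k$, $i=1,\dots,N$, which satisfy $\int_{\xi_{p-1}}^{\xi_p}e_i=\delta_{ip}$. The projection of $1$-forms is $\pi_hb^{(1)}=\sum_{i=1}^N\Big(\int_{\xi_{i-1}}^{\xi_i}b^{(1)}\Big)e_i$,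 and $\Lambda^1_h$ is its range. Standing assumption: the nodes are suitably chosen ((extended) Gauss or Gauss–Lobatto points), so that the $0$-form interpolant obeys the standard a priori error estimate $$\|a^{(0)}-\pi_ha^{(0)}\|_{H\Lambda^0}\le C_0\,\frac{h^{l-1}}{p^{m-1}}\,|a^{(0)}|_{H^m\Lambda^0},\qquad l=\min(p+1,m),$$ for $a^{(0)}\in H^m\Lambda^0$, $m\ge1$. Here $h$ is the grid size, $p$ the polynomial degree of the interpolant, $|\cdot|_{H^m\Lambda^0}$ the order-$m$ Sobolev semi-norm (with $|\cdot|_{H^1\Lambda^0}=|\cdot|_{H\Lambda^0}$), and $C_0$ a constant not depending on $a^{(0)}$, $h$, $p$. *)

theory Defs
  imports "HOL-Analysis.Analysis" "HOL-Computational_Algebra.Polynomial"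
begin

text \<open>
  A 0-form is a function on the reference interval, and a 1-form \<open>f(\<xi>) d\<xi>\<close> is represented by its
  coefficient \<open>f\<close>. Elements of \<open>L\<^sup>2\<close> are functions rather than equivalence classes.
\<close>

definition Omega_ref :: "real set"
  where "Omega_ref = {-1..1}"

definition L2 :: "(real \<Rightarrow> real) set"
  where "L2 = {f. f \<in> borel_measurable (lebesgue_on Omega_ref) \<and>
                  integrable (lebesgue_on Omega_ref) (\<lambda>x. (f x)\<^sup>2)}"

definition L2_norm :: "(real \<Rightarrow> real) \<Rightarrow> real"
  where "L2_norm f = sqrt (\<integral>x. (f x)\<^sup>2 \<partial>(lebesgue_on Omega_ref))"

definition test_function :: "(real \<Rightarrow> real) \<Rightarrow> bool"
  where "test_function \<phi> \<longleftrightarrow>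
    (\<forall>k. (deriv ^^ k) \<phi> differentiable_on UNIV) \<and> closure {x. \<phi> x \<noteq> 0} \<subseteq> interior Omega_ref"

definition has_weak_deriv :: "nat \<Rightarrow> (real \<Rightarrow> real) \<Rightarrow> (real \<Rightarrow> real) \<Rightarrow> bool"
  where "has_weak_deriv k a g \<longleftrightarrow>
    (\<forall>\<phi>. test_function \<phi> \<longrightarrow>
      (\<integral>x. a x * (deriv ^^ k) \<phi> x \<partial>(lebesgue_on Omega_ref)) =
      (-1) ^ k * (\<integral>x. g x * \<phi> x \<partial>(lebesgue_on Omega_ref)))"

definition H_space :: "nat \<Rightarrow> (real \<Rightarrow> real) set"
  where "H_space m = {a \<in> L2. \<forall>k\<le>m. \<exists>g\<in>L2. has_weak_deriv k a g}"

text \<open>A weak derivative is unique only up to a null set, hence the choice of a representative.\<close>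

definition weak_deriv :: "nat \<Rightarrow> (real \<Rightarrow> real) \<Rightarrow> real \<Rightarrow> real"
  where "weak_deriv k a = (SOME g. g \<in> L2 \<and> has_weak_deriv k a g)"

definition H_seminorm :: "nat \<Rightarrow> (real \<Rightarrow> real) \<Rightarrow> real"
  where "H_seminorm m a = L2_norm (weak_deriv m a)"

definition H_norm :: "(real \<Rightarrow> real) \<Rightarrow> real"
  where "H_norm a = sqrt ((L2_norm a)\<^sup>2 + (H_seminorm 1 a)\<^sup>2)"

definition nodes :: "nat \<Rightarrow> (nat \<Rightarrow> real) \<Rightarrow> bool"
  where "nodes N \<xi> \<longleftrightarrow> (\<forall>i\<le>N. \<xi> i \<in> Omega_ref) \<and> (\<forall>i<N. \<xi> i < \<xi> (Suc i))"

definition lagrange :: "nat \<Rightarrow> (nat \<Rightarrow> real) \<Rightarrow> nat \<Rightarrow> real poly"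
  where "lagrange N \<xi> i = (\<Prod>j\<in>{..N} - {i}. smult (1 / (\<xi> i - \<xi> j)) [:- \<xi> j, 1:])"

definition proj0 :: "nat \<Rightarrow> (nat \<Rightarrow> real) \<Rightarrow> (real \<Rightarrow> real) \<Rightarrow> real poly"
  where "proj0 N \<xi> a = (\<Sum>i\<le>N. smult (a (\<xi> i)) (lagrange N \<xi> i))"

definition edge :: "nat \<Rightarrow> (nat \<Rightarrow> real) \<Rightarrow> nat \<Rightarrow> real poly"
  where "edge N \<xi> i = - (\<Sum>k<i. pderiv (lagrange N \<xi> k))"

definition proj1 :: "nat \<Rightarrow> (nat \<Rightarrow> real) \<Rightarrow> (real \<Rightarrow> real) \<Rightarrow> real poly"
  where "proj1 N \<xi> b =
    (\<Sum>i=1..N. smult (\<integral>x. b x \<partial>(lebesgue_on {\<xi> (i - 1)..\<xi> i})) (edge N \<xi> i))"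

text \<open>
  The a priori estimate for a family of node sets, where \<open>\<xi> N\<close> are the nodes and \<open>h N\<close> the grid
  size for the polynomial degree \<open>N\<close>; the constant may depend on the Sobolev order \<open>m\<close>, but
  not on \<open>a\<close>, \<open>N\<close>, \<open>h\<close>.

  The pointwise values in \<open>proj0\<close> refer to the continuous representative of \<open>a\<close>, so continuity
  is asked for explicitly.

  The order is limited to \<open>m \<le> N + 1\<close>: with the pure semi-norm of order \<open>m\<close> the estimate is
  false beyond that, since for \<open>a(x) = x^(N+1)\<close> and \<open>m \<ge> N + 2\<close> the right-hand side is 0 while
  the interpolation error is not.
\<close>

definition interpolation_estimate ::
    "(nat \<Rightarrow> nat \<Rightarrow> real) \<Rightarrow> (nat \<Rightarrow> real) \<Rightarrow> (nat \<Rightarrow> real) \<Rightarrow> bool"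
  where "interpolation_estimate \<xi> h C\<^sub>0 \<longleftrightarrow>
    (\<forall>N m a. 1 \<le> N \<and> 1 \<le> m \<and> m \<le> N + 1 \<and> a \<in> H_space m \<and> continuous_on Omega_ref a \<longrightarrow>
      H_norm (\<lambda>x. a x - poly (proj0 N (\<xi> N) a) x)
        \<le> C\<^sub>0 m * (h N ^ (min (N + 1) m - 1) / real N ^ (m - 1)) * H_seminorm m a)"

end

theory Submission
  imports Defs
begin

text \<open>
  Let \<open>a(x) = \<integral>\<^sub>-\<^sub>1\<^sup>x b\<close> be the primitive of \<open>b\<close>. The projections commute with the exterior derivative,
  \<open>(\<pi>\<^sub>h a)' = \<pi>\<^sub>h b\<close>: sum by parts and use that the Lagrange polynomials add up to 1. Hence
  \<open>b - \<pi>\<^sub>h b\<close> is the weak derivative of \<open>a - \<pi>\<^sub>h a\<close>, and the a priori estimate of order \<open>m = 1\<close>, whose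
  factor in \<open>h\<close> and \<open>p\<close> is 1, gives \<open>\<parallel>b - \<pi>\<^sub>h b\<parallel> \<le> C\<^sub>0 \<parallel>b\<parallel>\<close> uniformly in \<open>N\<close>. Reading the semi-norms
  in this way needs the uniqueness of weak derivatives, hence enough smooth test functions.
\<close>

section \<open>Smooth bump functions\<close>

definition flat :: "real poly \<Rightarrow> real \<Rightarrow> real"
  where "flat p x = (if x > 0 then poly p (1 / x) * exp (- (1 / x)) else 0)"

text \<open>With \<open>y = 1 / x\<close> this describes flat functions as \<open>x\<close>
  decreases to 0: the exponential beats every power of \<open>1 / x\<close>.\<close>

lemma poly_times_exp_neg_tendsto_0: "((\<lambda>y. poly p y * exp (- y)) \<longlongrightarrow> (0::real)) at_top"
proof -
  have "((\<lambda>y. \<Sum>i\<le>degree p. coeff p i * (y ^ i / exp y)) \<longlongrightarrow> (\<Sum>i\<le>degree p. coeff p i * 0)) at_top"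
    by (intro tendsto_sum tendsto_mult tendsto_const tendsto_power_div_exp_0)
  moreover have "(\<lambda>y. \<Sum>i\<le>degree p. coeff p i * (y ^ i / exp y)) = (\<lambda>y. poly p y * exp (- y))"
    by (simp add: poly_altdef exp_minus divide_inverse sum_distrib_right mult.assoc)
  ultimately show ?thesis by simp
qed

lemma flat_smult: "flat (smult c p) x = c * flat p x"
  by (simp add: flat_def)

text \<open>For positive \<open>x\<close>, put \<open>y = 1 / x\<close>. Since
  \<open>dy/dx = - y^2\<close>, the derivative of \<open>p(y) exp(-y)\<close> is
  \<open>y^2 (p - p')(y) exp(-y)\<close>, which is again flat. At 0 both one-sided difference
  quotients tend to 0.\<close>

lemma flat_has_real_derivative:
  "(flat p has_real_derivative flat ([:0, 0, 1:] * (p - pderiv p)) x) (at x)"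
proof -
  consider "x > 0" | "x < 0" | "x = 0" by linarith
  then show ?thesis
  proof cases
    case 1
    have "((\<lambda>x. poly p (1 / x) * exp (- (1 / x))) has_real_derivative
        flat ([:0, 0, 1:] * (p - pderiv p)) x) (at x)"
      using 1 by (auto intro!: derivative_eq_intros DERIV_chain2[OF poly_DERIV]
          simp: flat_def field_simps power2_eq_square)
    then show ?thesis
      by (rule has_field_derivative_transform_within_open[where S = "{0<..}"]) (use 1 in \<open>auto simp: flat_def\<close>)
  next
    case 2
    have "((\<lambda>x. 0) has_real_derivative flat ([:0, 0, 1:] * (p - pderiv p)) x) (at x)"
      using 2 by (simp add: flat_def)
    then show ?thesis
      by (rule has_field_derivative_transform_within_open[where S = "{..<0}"]) (use 2 in \<open>auto simp: flat_def\<close>)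
  next
    case 3
    have "((\<lambda>y. flat p y / y) \<longlongrightarrow> 0) (at_right 0)"
    proof -
      \<comment> \<open>\<open>pCons 0 p\<close> is \<open>p\<close> times the variable. Evaluated
        at \<open>1 / y\<close>, the extra factor is exactly the division by \<open>y\<close> in the
        difference quotient.\<close>
      have "((\<lambda>y. poly (pCons 0 p) (inverse y) * exp (- inverse y)) \<longlongrightarrow> 0) (at_right 0)"
        using filterlim_compose[OF poly_times_exp_neg_tendsto_0 filterlim_inverse_at_top_right] .
      then show ?thesis
        by (rule Lim_transform_eventually)
          (auto simp: eventually_at_right_less flat_def field_simps
            intro: eventually_mono[OF eventually_at_right_less])
    qed
    moreover have "((\<lambda>y. flat p y / y) \<longlongrightarrow> 0) (at_left 0)"
      by (rule Lim_transform_eventually[OF tendsto_const])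
        (auto simp: flat_def eventually_at_left_field intro: exI[of _ "-1"])
    ultimately have "((\<lambda>y. flat p y / y) \<longlongrightarrow> 0) (at 0)"
      by (simp add: filterlim_split_at)
    then show ?thesis
      using 3 by (simp add: has_field_derivative_iff flat_def)
  qed
qed

text \<open>
  The flat functions of affine arguments and their sums and products are closed under
  differentiation, so all of them are smooth.
\<close>

inductive_set flat_algebra :: "(real \<Rightarrow> real) set" where
  flat: "(\<lambda>x. flat p (\<alpha> * x + \<beta>)) \<in> flat_algebra"
| add: "f \<in> flat_algebra \<Longrightarrow> g \<in> flat_algebra \<Longrightarrow> (\<lambda>x. f x + g x) \<in> flat_algebra"
| mult: "f \<in> flat_algebra \<Longrightarrow> g \<in> flat_algebra \<Longrightarrow> (\<lambda>x. f x * g x) \<in> flat_algebra"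

lemma flat_algebra_derivative:
  "f \<in> flat_algebra \<Longrightarrow> \<exists>g\<in>flat_algebra. \<forall>x. (f has_real_derivative g x) (at x)"
proof (induction rule: flat_algebra.induct)
  case (flat p \<alpha> \<beta>)
  let ?q = "smult \<alpha> ([:0, 0, 1:] * (p - pderiv p))"
  have "((\<lambda>x. flat p (\<alpha> * x + \<beta>)) has_real_derivative flat ?q (\<alpha> * x + \<beta>)) (at x)" for x
  proof -
    have "((\<lambda>x. \<alpha> * x + \<beta>) has_real_derivative \<alpha>) (at x)"
      by (auto intro!: derivative_eq_intros)
    from DERIV_chain2[OF flat_has_real_derivative this, of p] show ?thesis
      unfolding flat_smult by (simp add: mult.commute)
  qed
  then show ?case
    by (intro bexI[of _ "\<lambda>x. flat ?q (\<alpha> * x + \<beta>)"] allI flat_algebra.flat) auto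
next
  case (add f g)
  then obtain f' g' where *: "f' \<in> flat_algebra" "\<And>x. (f has_real_derivative f' x) (at x)"
    "g' \<in> flat_algebra" "\<And>x. (g has_real_derivative g' x) (at x)" by blast
  then show ?case
    by (intro bexI[of _ "\<lambda>x. f' x + g' x"] allI DERIV_add flat_algebra.add)
next
  case (mult f g)
  then obtain f' g' where *: "f' \<in> flat_algebra" "\<And>x. (f has_real_derivative f' x) (at x)"
    "g' \<in> flat_algebra" "\<And>x. (g has_real_derivative g' x) (at x)" by blast
  with mult.hyps show ?case
    by (intro bexI[of _ "\<lambda>x. f' x * g x + g' x * f x"] allI DERIV_mult
        flat_algebra.add flat_algebra.mult)
qed

lemma higher_deriv_flat_algebra: "f \<in> flat_algebra \<Longrightarrow> (deriv ^^ k) f \<in> flat_algebra"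
proof (induction k)
  case (Suc k)
  then obtain g where g: "g \<in> flat_algebra" "\<And>x. ((deriv ^^ k) f has_real_derivative g x) (at x)"
    using flat_algebra_derivative by blast
  then have "deriv ((deriv ^^ k) f) = g"
    using DERIV_imp_deriv by blast
  then show ?case using g by simp
qed simp

lemma flat_algebra_test_function:
  assumes "f \<in> flat_algebra" and supp: "\<And>x. f x \<noteq> 0 \<Longrightarrow> x \<in> {c..d}" and "-1 < c" "d < 1"
  shows "test_function f"
  unfolding test_function_def
proof (intro conjI allI)
  fix k
  show "(deriv ^^ k) f differentiable_on UNIV"
    using flat_algebra_derivative[OF higher_deriv_flat_algebra[OF assms(1)]]
    unfolding differentiable_on_def
    by (meson UNIV_I differentiable_at_withinI real_differentiable_def)
next
  have "closure {x. f x \<noteq> 0} \<subseteq> {c..d}"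
    using supp by (intro closure_minimal) auto
  also have "\<dots> \<subseteq> interior Omega_ref"
    using assms(3,4) by (auto simp: Omega_ref_def)
  finally show "closure {x. f x \<noteq> 0} \<subseteq> interior Omega_ref" .
qed

text \<open>
  For \<open>t \<le> 1\<close> this is supported in \<open>[-1 + 1/n, t - 1/n]\<close>, inside the open reference interval, and it
  tends to the indicator of \<open>(-1, t)\<close>.
\<close>

definition bump :: "real \<Rightarrow> nat \<Rightarrow> real \<Rightarrow> real"
  where "bump t n x = flat 1 (real n * (x + 1) - 1) * flat 1 (real n * (t - x) - 1)"

lemma flat_1_bounds: "0 \<le> flat 1 x" "flat 1 x \<le> 1"
  by (auto simp: flat_def)

lemma bump_bounds: "0 \<le> bump t n x" "bump t n x \<le> 1"
  using flat_1_bounds unfolding bump_def by (auto intro!: mult_le_one)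

lemma test_function_bump:
  assumes "t \<le> 1"
  shows "test_function (bump t n)"
\<comment> \<open>For \<open>n = 0\<close> the bounds \<open>-1 + 1 / n\<close> and
  \<open>t - 1 / n\<close> would read \<open>-1\<close> and \<open>t\<close>, as
  \<open>1 / 0 = 0\<close>, and the support would not be kept away from -1. Both arguments of
  \<open>flat\<close> are then -1, so the bump is identically 0.\<close>
proof (cases "n = 0")
  case True
  then have "bump t n = (\<lambda>x. flat 0 (0 * x + 0))"
    by (auto simp: bump_def flat_def)
  then have "bump t n \<in> flat_algebra"
    using flat_algebra.flat by metis
  moreover have "bump t n x = 0" for x
    using True by (simp add: bump_def flat_def)
  ultimately show ?thesis
    by (intro flat_algebra_test_function[of _ 0 0]) auto
next
  case False
  have eq: "bump t n = (\<lambda>x. flat 1 (real n * x + (real n - 1)) * flat 1 ((- real n) * x + (real n * t - 1)))"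
    by (auto simp: bump_def algebra_simps)
  have "bump t n \<in> flat_algebra"
    unfolding eq by (intro flat_algebra.mult flat_algebra.flat)
  then show ?thesis
  \<comment> \<open>This interval may be empty, for instance when \<open>n\<close> is small. The
    bump is then 0 everywhere and the inclusion of its support still holds.\<close>
  proof (rule flat_algebra_test_function[where c = "-1 + 1 / n" and d = "t - 1 / n"])
    fix x assume "bump t n x \<noteq> 0"
    then have "0 < real n * (x + 1) - 1" "0 < real n * (t - x) - 1"
      by (auto simp: bump_def flat_def split: if_splits)
    then show "x \<in> {-1 + 1 / n..t - 1 / n}"
      using False by (auto simp: field_simps)
  next
    have "0 < 1 / real n" using False by simp
    then show "-1 < -1 + 1 / real n" "t - 1 / real n < 1" using assms by linarith+
  qed
qed

lemma flat_1_scale_tendsto: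
  assumes "y > 0"
  shows "(\<lambda>n. flat 1 (real n * y - 1)) \<longlonglongrightarrow> 1"
proof -
  have lim: "filterlim (\<lambda>n. real n * y - 1) at_top sequentially"
    using filterlim_tendsto_add_at_top[OF tendsto_const[of "-1"]
        filterlim_at_top_mult_tendsto_pos[OF tendsto_const assms filterlim_real_sequentially]]
    by simp
  have "(\<lambda>n. exp (- (1 / (real n * y - 1)))) \<longlonglongrightarrow> exp (- 0)"
    by (intro tendsto_exp tendsto_minus tendsto_divide_0[OF tendsto_const]
        filterlim_at_top_imp_at_infinity lim)
  then have "(\<lambda>n. exp (- (1 / (real n * y - 1)))) \<longlonglongrightarrow> 1"
    by simp
  then show ?thesis
    by (rule Lim_transform_eventually)
      (use filterlim_at_top_dense[THEN iffD1, OF lim, rule_format, of 0] in \<open>auto simp: flat_def elim!: eventually_mono\<close>)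
qed

lemma bump_tendsto: "(\<lambda>n. bump t n x) \<longlonglongrightarrow> indicator {-1<..<t} x"
proof (cases "x \<in> {-1<..<t}")
  case True
  then have "(\<lambda>n. bump t n x) \<longlonglongrightarrow> 1 * 1"
    unfolding bump_def by (intro tendsto_mult flat_1_scale_tendsto) auto
  with True show ?thesis by simp
next
  case False
  have "bump t n x = 0" for n
  proof -
    \<comment> \<open>Outside the open interval one of the two arguments of \<open>flat\<close> is
      at most -1 for every \<open>n\<close>, so the sequence is constantly 0, also at the end
      points.\<close>
    have "real n * (x + 1) \<le> 0 \<or> real n * (t - x) \<le> 0"
      using False by (auto simp: mult_le_0_iff)
    then show ?thesis by (auto simp: bump_def flat_def)
  qed
  with False show ?thesis by simp
qed

section \<open>Square-integrable functions and weak derivatives\<close>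

text \<open>The spaces are defined by Lebesgue measurable functions, whereas the arguments below by
  generators of the Borel sets and by Fubini run over \<open>lborel\<close>. A Borel function equal
  almost everywhere, cut off outside \<open>S\<close>, mediates between the two.\<close>

lemma lborel_representative:
  fixes u :: "'a::euclidean_space \<Rightarrow> real"
  assumes "integrable (lebesgue_on S) u" and [measurable]: "S \<in> sets borel"
  obtains v where "integrable lborel v" "\<And>x. x \<notin> S \<Longrightarrow> v x = 0" "AE x in lebesgue_on S. u x = v x"
proof -
  have u: "integrable lebesgue (\<lambda>x. indicator S x *\<^sub>R u x)"
    using assms(1) by (subst (asm) integrable_restrict_space) auto
  then obtain g where g[measurable]: "g \<in> borel_measurable lborel"
    and ae: "AE x in lborel. indicator S x *\<^sub>R u x = g x"
    using completion_ex_borel_measurable_real[OF borel_measurable_integrable[OF u]] by auto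
  define v where "v x = indicator S x * g x" for x
  have v[measurable]: "v \<in> borel_measurable lborel"
    unfolding v_def by measurable
  have ae': "AE x in lebesgue. indicator S x *\<^sub>R u x = v x"
    using AE_completion[OF ae] by eventually_elim (auto simp: v_def indicator_def split: if_splits)
  have "integrable lebesgue v"
    using integrable_cong_AE_imp[OF u measurable_completion[OF v]] ae' by (simp add: eq_commute)
  then have "integrable lborel v"
    using integrable_completion[OF v] by simp
  moreover have "AE x in lebesgue_on S. u x = v x"
    using ae' by (subst AE_restrict_space_iff) (auto simp: indicator_def)
  ultimately show ?thesis
    using that by (auto simp: v_def)
qed

lemma integral_lebesgue_on_eq_lborel:
  fixes f :: "'a::euclidean_space \<Rightarrow> real"
  assumes [measurable]: "f \<in> borel_measurable lborel" and "S \<in> sets borel" "\<And>x. x \<notin> S \<Longrightarrow> f x = 0"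
  shows "(\<integral>x. f x \<partial>lebesgue_on S) = (\<integral>x. f x \<partial>lborel)"
proof -
  have "(\<lambda>x. indicator S x *\<^sub>R f x) = f"
    using assms(3) by (auto simp: indicator_def fun_eq_iff)
  then have "(\<integral>x. f x \<partial>lebesgue_on S) = (\<integral>x. f x \<partial>lebesgue)"
    using assms(2) by (subst integral_restrict_space) auto
  then show ?thesis
    by (simp add: integral_completion)
qed

text \<open>A Dynkin argument: the open half-lines are stable under intersection and generate the
  Borel sets, and the sets over which the integral of \<open>w\<close> vanishes are closed under
  complements, thanks to the total integral, and under countable disjoint unions. So
  \<open>w\<close> and 0 have the same integral over every Borel set.\<close>

lemma AE_zero_if_lessThan_integrals_zero:
  fixes w :: "real \<Rightarrow> real"
  assumes w: "integrable lborel w" and zero: "\<And>t. (LBINT x:{..<t}. w x) = 0" and "(LBINT x. w x) = 0"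
  shows "AE x in lborel. w x = 0"
proof (rule density_unique_real[OF w])
  fix A :: "real set" assume A: "A \<in> sets lborel"
  have gen: "sets borel = sigma_sets UNIV (range (lessThan :: real \<Rightarrow> _))"
    by (simp add: borel_Iio)
  have stable: "Int_stable (range (lessThan :: real \<Rightarrow> _))"
  proof (rule Int_stableI_image)
    fix s t :: real
    have "{..<s} \<inter> {..<t} = {..<min s t}" by auto
    then show "\<exists>k\<in>UNIV. {..<s} \<inter> {..<t} = {..<k}" by blast
  qed
  have "range lessThan \<subseteq> Pow (UNIV :: real set)" and "A \<in> sigma_sets UNIV (range lessThan)"
    using A by (auto simp flip: gen)
  with stable have "(LBINT x:A. w x) = 0"
  proof (induction A rule: sigma_sets_induct_disjoint)
    case (compl A)
    then have [measurable]: "A \<in> sets borel" by (simp add: gen)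
    have "integrable lborel (\<lambda>x. indicator A x *\<^sub>R w x)"
      using w by (intro integrable_mult_indicator) auto
    moreover have "(LBINT x:UNIV - A. w x) = (LBINT x. w x - indicator A x *\<^sub>R w x)"
      unfolding set_lebesgue_integral_def
      by (intro Bochner_Integration.integral_cong) (auto simp: indicator_def)
    ultimately have "(LBINT x:UNIV - A. w x) = (LBINT x. w x) - (LBINT x:A. w x)"
      unfolding set_lebesgue_integral_def using w by simp
    then show ?case using compl assms(3) by simp
  next
    case (union A)
    have [measurable]: "A i \<in> sets borel" for i
      using union by (auto simp: gen)
    have "(LBINT x:(\<Union>i. A i). w x) = (\<Sum>i. (LBINT x:A i. w x))"
    proof (rule lebesgue_integral_countable_add)
      show "set_integrable lborel (\<Union>i. A i) w"
        unfolding set_integrable_def using w by (intro integrable_mult_indicator) auto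
    qed (use union in \<open>auto simp: disjoint_family_on_def\<close>)
    with union show ?case by simp
  qed (use zero in \<open>auto simp: set_lebesgue_integral_def\<close>)
  then show "(LBINT x:A. w x) = (LBINT x:A. 0)"
    by (simp add: set_lebesgue_integral_def)
qed simp

lemma continuous_bump: "continuous_on S (bump t n)"
  unfolding bump_def
  by (intro continuous_intros continuous_on_compose2[OF DERIV_continuous_on[OF
        has_field_derivative_at_within[OF flat_has_real_derivative]], where t = UNIV]) auto

lemma Omega_ref_borel [measurable, simp]: "Omega_ref \<in> sets borel"
  by (simp add: Omega_ref_def)

text \<open>The bumps are enough as test functions. By dominated convergence they show that the
  integral over \<open>(-1, t)\<close> vanishes for all \<open>t\<close> up to 1, which determines
  the function almost everywhere.\<close>

lemma fundamental_lemma: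
  assumes u: "integrable (lebesgue_on Omega_ref) u"
    and ortho: "\<And>\<phi>. test_function \<phi> \<Longrightarrow> (\<integral>x. u x * \<phi> x \<partial>lebesgue_on Omega_ref) = 0"
  shows "AE x in lebesgue_on Omega_ref. u x = 0"
proof -
  obtain v where v: "integrable lborel v" and v0: "\<And>x. x \<notin> Omega_ref \<Longrightarrow> v x = 0"
    and uv: "AE x in lebesgue_on Omega_ref. u x = v x"
    using lborel_representative[OF u] by auto
  note [measurable] = borel_measurable_integrable[OF v] borel_measurable_integrable[OF u]
  have [measurable]: "bump t n \<in> borel_measurable borel" for t n
    using borel_measurable_continuous_onI[OF continuous_bump] .
  have bump_zero: "(LBINT x. v x * bump t n x) = 0" if "t \<le> 1" for t n
  proof -
    have "(LBINT x. v x * bump t n x) = (\<integral>x. v x * bump t n x \<partial>lebesgue_on Omega_ref)"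
      by (rule integral_lebesgue_on_eq_lborel[symmetric]) (auto simp: v0)
    also have "\<dots> = (\<integral>x. u x * bump t n x \<partial>lebesgue_on Omega_ref)"
    proof (rule integral_cong_AE)
      show "AE x in lebesgue_on Omega_ref. v x * bump t n x = u x * bump t n x"
        using uv by eventually_elim simp
    qed (measurable; simp add: measurable_restrict_space1 measurable_completion)+
    finally show ?thesis
      using ortho[OF test_function_bump[OF that]] by simp
  qed
  \<comment> \<open>The bumps converge to indicators of open intervals, so only the restriction to
    the open reference interval is controlled. The two end points are added later as a null
    set.\<close>
  define w where "w x = indicator {-1<..<1} x * v x" for x
  have w: "integrable lborel w"
    unfolding w_def using integrable_mult_indicator[OF _ v, of "{-1<..<1}"] by simp
  have interval_zero: "(LBINT x. v x * indicator {-1<..<t} x) = 0" if "t \<le> 1" for t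
  proof -
    have "(\<lambda>n. LBINT x. v x * bump t n x) \<longlonglongrightarrow> (LBINT x. v x * indicator {-1<..<t} x)"
    proof (rule integral_dominated_convergence[where w = "\<lambda>x. \<bar>v x\<bar>"])
      show "AE x in lborel. (\<lambda>n. v x * bump t n x) \<longlonglongrightarrow> v x * indicator {-1<..<t} x"
        by (intro AE_I2 tendsto_mult tendsto_const bump_tendsto)
      show "AE x in lborel. norm (v x * bump t n x) \<le> \<bar>v x\<bar>" for n
        using bump_bounds[of t n] by (auto simp: abs_mult intro!: mult_left_le)
    qed (use v in auto)
    then show ?thesis
      using bump_zero[OF that] LIMSEQ_unique[OF _ tendsto_const] by fastforce
  qed
  have "AE x in lborel. w x = 0"
  proof (rule AE_zero_if_lessThan_integrals_zero[OF w])
    \<comment> \<open>Bumps are test functions only for \<open>t\<close> up to 1. Since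
      \<open>w\<close> vanishes from 1 on, a larger half-line contributes nothing new.\<close>
    have "(LBINT x:{..<t}. w x) = (LBINT x. v x * indicator {-1<..<min t 1} x)" for t
      unfolding set_lebesgue_integral_def w_def
      by (intro Bochner_Integration.integral_cong) (auto simp: indicator_def)
    then show "(LBINT x:{..<t}. w x) = 0" for t
      using interval_zero[of "min t 1"] by simp
    show "(LBINT x. w x) = 0"
      using interval_zero[of 1] by (simp add: w_def mult.commute)
  qed
  then have "AE x in lborel. v x = 0"
    using AE_lborel_singleton[of 1] AE_lborel_singleton[of "-1"]
  proof eventually_elim
    case (elim x)
    then show ?case using v0[of x] by (cases "x \<in> Omega_ref") (auto simp: w_def Omega_ref_def)
  qed
  then have "AE x in lebesgue. v x = 0"
    by (rule AE_completion)
  then have "AE x in lebesgue_on Omega_ref. v x = 0"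
    by (subst AE_restrict_space_iff) auto
  with uv show ?thesis
    by eventually_elim simp
qed

section \<open>Elementary properties of square-integrable functions\<close>

lemma L2_integrable:
  assumes "f \<in> L2"
  shows "integrable (lebesgue_on Omega_ref) f"
proof (rule Bochner_Integration.integrable_bound)
  have "emeasure (lebesgue_on Omega_ref) (space (lebesgue_on Omega_ref)) < \<infinity>"
    by (simp add: emeasure_restrict_space space_restrict_space Omega_ref_def)
  then interpret finite_measure "lebesgue_on Omega_ref"
    by (intro finite_measureI) auto
  show "integrable (lebesgue_on Omega_ref) (\<lambda>x. 1 + (f x)\<^sup>2)"
    using assms by (auto simp: L2_def)
  \<comment> \<open>The square of \<open>|y| - 1\<close> is nonnegative, which even bounds
    \<open>2 |y|\<close>. The constant 1 is integrable as the reference interval has finite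
    measure.\<close>
  have "\<bar>y\<bar> \<le> 1 + y\<^sup>2" for y :: real
    using zero_le_power2[of "\<bar>y\<bar> - 1"] abs_ge_zero[of y] unfolding power2_diff power2_abs one_power2
    by linarith
  then show "AE x in lebesgue_on Omega_ref. norm (f x) \<le> norm (1 + (f x)\<^sup>2)"
    by auto
qed (use assms in \<open>auto simp: L2_def\<close>)

lemma L2_diff:
  assumes "f \<in> L2" "g \<in> L2"
  shows "(\<lambda>x. f x - g x) \<in> L2"
proof -
  have [measurable]: "f \<in> borel_measurable (lebesgue_on Omega_ref)" "g \<in> borel_measurable (lebesgue_on Omega_ref)"
    using assms by (auto simp: L2_def)
  have "integrable (lebesgue_on Omega_ref) (\<lambda>x. 2 * (f x)\<^sup>2 + 2 * (g x)\<^sup>2)"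
    using assms by (auto simp: L2_def)
  then have "integrable (lebesgue_on Omega_ref) (\<lambda>x. (f x - g x)\<^sup>2)"
  proof (rule Bochner_Integration.integrable_bound)
    have "(f x - g x)\<^sup>2 \<le> 2 * (f x)\<^sup>2 + 2 * (g x)\<^sup>2" for x
      using zero_le_power2[of "f x + g x"] by (simp add: power2_sum power2_diff)
    then show "AE x in lebesgue_on Omega_ref. norm ((f x - g x)\<^sup>2) \<le> norm (2 * (f x)\<^sup>2 + 2 * (g x)\<^sup>2)"
      by auto
  qed simp
  then show ?thesis
    by (simp add: L2_def)
qed

lemma L2_norm_power2: "(L2_norm f)\<^sup>2 = (\<integral>x. (f x)\<^sup>2 \<partial>lebesgue_on Omega_ref)"
  by (simp add: L2_norm_def)

text \<open>Takes the place of the triangle inequality at the price of a factor 2. It holds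
  pointwise: the right integrand minus the left one is the square of \<open>2 f - g\<close>.\<close>

lemma L2_norm_triangle_power2:
  assumes "f \<in> L2" "g \<in> L2"
  shows "(L2_norm g)\<^sup>2 \<le> 2 * (L2_norm f)\<^sup>2 + 2 * (L2_norm (\<lambda>x. f x - g x))\<^sup>2"
proof -
  have int: "integrable (lebesgue_on Omega_ref) (\<lambda>x. (u x)\<^sup>2)" if "u \<in> L2" for u
    using that by (simp add: L2_def)
  have "(L2_norm g)\<^sup>2 \<le> (\<integral>x. 2 * (f x)\<^sup>2 + 2 * (f x - g x)\<^sup>2 \<partial>lebesgue_on Omega_ref)"
    unfolding L2_norm_power2
  proof (intro integral_mono)
    fix x
    show "(g x)\<^sup>2 \<le> 2 * (f x)\<^sup>2 + 2 * (f x - g x)\<^sup>2"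
      using zero_le_power2[of "2 * f x - g x"] by (simp add: power2_diff algebra_simps power_mult_distrib)
  qed (use int assms int[OF L2_diff] in auto)
  also have "\<dots> = 2 * (L2_norm f)\<^sup>2 + 2 * (L2_norm (\<lambda>x. f x - g x))\<^sup>2"
    unfolding L2_norm_power2 using int assms int[OF L2_diff] by simp
  finally show ?thesis .
qed

section \<open>Integrals over subintervals and continuous integrands\<close>

lemma integrable_on_Icc_subset_Omega_ref:
  fixes b :: "real \<Rightarrow> real"
  assumes "integrable (lebesgue_on Omega_ref) b" "{p..q} \<subseteq> Omega_ref"
  shows "integrable (lebesgue_on {p..q}) b"
  using assms unfolding Omega_ref_def by (rule integrable_subinterval)

text \<open>Expresses the edge integrals in \<open>proj1\<close> as increments of the primitive that
  starts at -1. Additivity over adjacent intervals is taken from the gauge integral, with which the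
  Lebesgue integral agrees here.\<close>

lemma integral_lebesgue_on_Icc_split:
  fixes b :: "real \<Rightarrow> real"
  assumes "integrable (lebesgue_on Omega_ref) b" "-1 \<le> s" "s \<le> t" "t \<le> 1"
  shows "(\<integral>x. b x \<partial>lebesgue_on {s..t}) = (\<integral>x. b x \<partial>lebesgue_on {-1..t}) - (\<integral>x. b x \<partial>lebesgue_on {-1..s})"
proof -
  have int: "integrable (lebesgue_on {p..q}) b" if "-1 \<le> p" "q \<le> 1" for p q
    using integrable_on_Icc_subset_Omega_ref[OF assms(1)] that by (auto simp: Omega_ref_def)
  have eq: "(\<integral>x. b x \<partial>lebesgue_on {p..q}) = integral {p..q} b" if "-1 \<le> p" "q \<le> 1" for p q
    by (rule lebesgue_integral_eq_integral[OF int[OF that]]) simp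
  have "b integrable_on {-1..t}"
    using integrable_on_lebesgue_on[OF int[of "-1" t]] assms(4) by simp
  from Henstock_Kurzweil_Integration.integral_combine[OF assms(2,3) this]
  show ?thesis
    using eq[of s t] eq[of "-1" t] eq[of "-1" s] assms(2-4) by simp
qed

lemma integral_lebesgue_on_poly_pderiv:
  fixes P :: "real poly"
  assumes "a \<le> b"
  shows "(\<integral>x. poly (pderiv P) x \<partial>lebesgue_on {a..b}) = poly P b - poly P a"
proof -
  have "(poly (pderiv P) has_integral (poly P b - poly P a)) {a..b}"
    using assms by (rule fundamental_theorem_of_calculus)
      (simp add: has_field_derivative_at_within poly_DERIV flip: has_real_derivative_iff_has_vector_derivative)
  moreover have "integrable (lebesgue_on {a..b}) (poly (pderiv P))"
    by (intro continuous_imp_integrable_real continuous_intros)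
  ultimately show ?thesis
    by (simp add: lebesgue_integral_eq_integral integral_unique)
qed

lemma continuous_on_imp_L2:
  assumes "continuous_on Omega_ref f"
  shows "f \<in> L2"
  unfolding L2_def
proof (intro CollectI conjI)
  show "f \<in> borel_measurable (lebesgue_on Omega_ref)"
    using assms by (auto intro: continuous_imp_measurable_on_sets_lebesgue)
  have "continuous_on {-1..1} (\<lambda>x. (f x)\<^sup>2)"
    using assms unfolding Omega_ref_def by (intro continuous_intros)
  then show "integrable (lebesgue_on Omega_ref) (\<lambda>x. (f x)\<^sup>2)"
    unfolding Omega_ref_def by (rule continuous_imp_integrable_real)
qed

lemma L2_mult_integrable:
  assumes "f \<in> L2" "g \<in> L2"
  shows "integrable (lebesgue_on Omega_ref) (\<lambda>x. f x * g x)"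
proof (rule Bochner_Integration.integrable_bound)
  show "integrable (lebesgue_on Omega_ref) (\<lambda>x. (f x)\<^sup>2 + (g x)\<^sup>2)"
    using assms by (auto simp: L2_def)
  have "\<bar>y * z\<bar> \<le> y\<^sup>2 + z\<^sup>2" for y z :: real
  proof -
    have "2 * (\<bar>y\<bar> * \<bar>z\<bar>) \<le> y\<^sup>2 + z\<^sup>2" and "0 \<le> \<bar>y\<bar> * \<bar>z\<bar>"
      using sum_squares_bound[of "\<bar>y\<bar>" "\<bar>z\<bar>"] by auto
    then show ?thesis unfolding abs_mult by linarith
  qed
  then show "AE x in lebesgue_on Omega_ref. norm (f x * g x) \<le> norm ((f x)\<^sup>2 + (g x)\<^sup>2)"
    by auto
qed (use assms in \<open>auto simp: L2_def\<close>)

section \<open>Test functions, weak derivatives and primitives\<close>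

lemma test_function_differentiable:
  assumes "test_function \<phi>"
  shows "((deriv ^^ k) \<phi> has_real_derivative (deriv ^^ Suc k) \<phi> x) (at x)"
  using assms unfolding test_function_def
  by (simp add: DERIV_deriv_iff_real_differentiable differentiable_on_def)

lemma test_function_continuous:
  assumes "test_function \<phi>"
  shows "continuous_on S ((deriv ^^ k) \<phi>)"
  by (rule DERIV_continuous_on[OF has_field_derivative_at_within[OF test_function_differentiable[OF assms]]])

text \<open>The end points are included because the closed support lies in the interior. This
  removes the boundary terms when integrating by parts.\<close>

lemma test_function_eq_0:
  assumes "test_function \<phi>" "x \<notin> {-1<..<1}"
  shows "\<phi> x = 0"
  using assms closure_subset[of "{x. \<phi> x \<noteq> 0}"]
  by (auto simp: test_function_def Omega_ref_def subset_eq)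

text \<open>The sign \<open>(-1) ^ k\<close> cancels, so the difference of two weak derivatives is
  orthogonal to all test functions and the fundamental lemma applies.\<close>

lemma has_weak_deriv_AE_unique:
  assumes "f \<in> L2" "g \<in> L2" "has_weak_deriv k a f" "has_weak_deriv k a g"
  shows "AE x in lebesgue_on Omega_ref. f x = g x"
proof -
  have "AE x in lebesgue_on Omega_ref. f x - g x = 0"
  proof (rule fundamental_lemma)
    show "integrable (lebesgue_on Omega_ref) (\<lambda>x. f x - g x)"
      using assms L2_integrable by auto
    fix \<phi> assume \<phi>: "test_function \<phi>"
    have "\<phi> \<in> L2"
      using test_function_continuous[OF \<phi>, of _ 0] by (intro continuous_on_imp_L2) simp
    then have int: "integrable (lebesgue_on Omega_ref) (\<lambda>x. f x * \<phi> x)" if "f \<in> L2" for f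
      using that by (rule L2_mult_integrable[rotated])
    have "(-1) ^ k * (\<integral>x. f x * \<phi> x \<partial>lebesgue_on Omega_ref) = (-1) ^ k * (\<integral>x. g x * \<phi> x \<partial>lebesgue_on Omega_ref)"
      using assms(3,4) \<phi> by (simp add: has_weak_deriv_def)
    then show "(\<integral>x. (f x - g x) * \<phi> x \<partial>lebesgue_on Omega_ref) = 0"
      using int assms(1,2) by (simp add: left_diff_distrib)
  qed
  then show ?thesis by simp
qed

text \<open>\<open>weak_deriv\<close> is an unspecified choice. By uniqueness almost everywhere, any
  explicitly known weak derivative in \<open>L2\<close> may be used to compute the
  semi-norm.\<close>

lemma H_seminorm_eq:
  assumes "g \<in> L2" "has_weak_deriv m a g"
  shows "H_seminorm m a = L2_norm g"
proof -
  have *: "weak_deriv m a \<in> L2 \<and> has_weak_deriv m a (weak_deriv m a)"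
    unfolding weak_deriv_def by (rule someI[of _ g]) (use assms in auto)
  have "(\<integral>x. (weak_deriv m a x)\<^sup>2 \<partial>lebesgue_on Omega_ref) = (\<integral>x. (g x)\<^sup>2 \<partial>lebesgue_on Omega_ref)"
  proof (rule integral_cong_AE)
    show "AE x in lebesgue_on Omega_ref. (weak_deriv m a x)\<^sup>2 = (g x)\<^sup>2"
      using has_weak_deriv_AE_unique[of "weak_deriv m a" g m a] assms * by auto
  qed (use assms * in \<open>auto simp: L2_def\<close>)
  then show ?thesis
    by (simp add: H_seminorm_def L2_norm_def)
qed

text \<open>Integration by parts through Fubini, as \<open>g\<close> is merely integrable. In the
  double integral of \<open>g(t) \<phi>'(x)\<close> over \<open>t \<le> x\<close> the order is
  exchanged; the inner integral of \<open>\<phi>'\<close> from \<open>t\<close> to 1 is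
  \<open>- \<phi>(t)\<close>. The constant \<open>c\<close> drops out because \<open>\<phi>'\<close>
  has total integral 0.\<close>

lemma has_weak_deriv_indefinite_integral:
  assumes g: "integrable (lebesgue_on Omega_ref) g"
    and a: "\<And>x. x \<in> Omega_ref \<Longrightarrow> a x = c + (\<integral>t. g t \<partial>lebesgue_on {-1..x})"
  shows "has_weak_deriv 1 a g"
  unfolding has_weak_deriv_def
proof (intro allI impI)
  fix \<phi> assume \<phi>: "test_function \<phi>"
  obtain v where v: "integrable lborel v" and v0: "\<And>x. x \<notin> Omega_ref \<Longrightarrow> v x = 0"
    and gv: "AE x in lebesgue_on Omega_ref. g x = v x"
    using lborel_representative[OF g] by auto
  note [measurable] = borel_measurable_integrable[OF v] borel_measurable_integrable[OF g]
  have [measurable]: "(deriv ^^ k) \<phi> \<in> borel_measurable borel" for k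
    by (rule borel_measurable_continuous_onI) (rule test_function_continuous[OF \<phi>])
  note [measurable] = this[of 0, simplified] this[of 1, simplified]
  define \<psi> where "\<psi> x = indicator {-1..1} x * deriv \<phi> x" for x
  have \<psi>[measurable]: "integrable lborel \<psi>"
    using borel_integrable_atLeastAtMost'[OF test_function_continuous[OF \<phi>, of _ 1]]
    by (simp add: \<psi>_def[abs_def] set_integrable_def)
  have FTC: "(LBINT x. indicator {t..1} x * deriv \<phi> x) = - \<phi> t" if "t \<le> 1" for t
    using integral_FTC_atLeastAtMost[OF that, of \<phi> "deriv \<phi>"]
      test_function_differentiable[OF \<phi>, of 0] test_function_continuous[OF \<phi>, of _ 1]
      test_function_eq_0[OF \<phi>, of 1]
    by (auto simp: has_field_derivative_at_within has_real_derivative_iff_has_vector_derivative[symmetric])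
  have \<psi>_tail: "(LBINT x. indicator {t..} x * \<psi> x) = - \<phi> t" if "t \<in> Omega_ref" for t
    using that FTC[of t] by (subst Bochner_Integration.integral_cong[of lborel lborel])
      (auto simp: \<psi>_def Omega_ref_def indicator_def)
  have \<psi>_total: "(LBINT x. \<psi> x) = 0"
    using FTC[of "-1"] test_function_eq_0[OF \<phi>, of "-1"] by (simp add: \<psi>_def)
  have a_eq: "a x = c + (LBINT t. indicator {t..} x * v t)" if x: "x \<in> Omega_ref" for x
  proof -
    have sub: "{-1..x} \<subseteq> Omega_ref" using x by (auto simp: Omega_ref_def)
    have ae: "AE t in lebesgue_on {-1..x}. g t = v t"
      using gv sub by (subst AE_restrict_space_iff, simp, subst (asm) AE_restrict_space_iff) (auto elim!: eventually_mono)
    have "(\<integral>t. g t \<partial>lebesgue_on {-1..x}) = (\<integral>t. indicator {-1..x} t * v t \<partial>lebesgue_on {-1..x})"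
    proof (rule integral_cong_AE)
      show "g \<in> borel_measurable (lebesgue_on {-1..x})"
        using sub by (rule measurable_restrict_mono[rotated]) simp
      show "AE t in lebesgue_on {-1..x}. g t = indicator {-1..x} t * v t"
        using ae AE_space by eventually_elim (auto simp: space_restrict_space)
    qed (intro measurable_restrict_space1 measurable_completion, measurable)
    also have "\<dots> = (LBINT t. indicator {-1..x} t * v t)"
      by (rule integral_lebesgue_on_eq_lborel) auto
    \<comment> \<open>Where \<open>v\<close> does not vanish, \<open>t\<close> is at least -1, and
      both indicators say that \<open>t\<close> is at most \<open>x\<close>. The second form is the
      one that can be read in either variable for Fubini.\<close>
    also have "\<dots> = (LBINT t. indicator {t..} x * v t)"
      using x v0 by (intro Bochner_Integration.integral_cong) (auto simp: indicator_def Omega_ref_def)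
    finally show ?thesis using a[OF x] by simp
  qed
  have [measurable]: "(\<lambda>x. LBINT t. indicator {t..} x * v t) \<in> borel_measurable borel"
  proof -
    have [measurable]: "v \<in> borel_measurable borel" by simp
    have "(\<lambda>x. LBINT t. (if t \<le> x then 1 else 0) * v t) \<in> borel_measurable borel"
      by measurable
    then show ?thesis
      by (simp add: indicator_def of_bool_def)
  qed
  \<comment> \<open>The kernel is dominated by the tensor product of the integrable functions
    \<open>v\<close> and \<open>\<psi>\<close>, since the indicator is at most 1.\<close>
  have prod: "integrable (lborel \<Otimes>\<^sub>M lborel) (\<lambda>(x, t). indicator {t..} x * v t * \<psi> x)"
  proof (rule Bochner_Integration.integrable_bound)
    show "integrable (lborel \<Otimes>\<^sub>M lborel) (\<lambda>(x, t). v t * \<psi> x)"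
      using v \<psi> by (intro lborel_pair.Fubini_integrable) (auto simp: abs_mult)
  qed (auto simp: indicator_def)
  have "(\<integral>x. a x * (deriv ^^ 1) \<phi> x \<partial>lebesgue_on Omega_ref)
      = (\<integral>x. (c + (LBINT t. indicator {t..} x * v t)) * \<psi> x \<partial>lebesgue_on Omega_ref)"
    by (intro Bochner_Integration.integral_cong) (auto simp: a_eq \<psi>_def space_restrict_space Omega_ref_def)
  also have "\<dots> = (LBINT x. (c + (LBINT t. indicator {t..} x * v t)) * \<psi> x)"
    by (intro integral_lebesgue_on_eq_lborel) (auto simp: \<psi>_def Omega_ref_def)
  also have "\<dots> = (LBINT x. c * \<psi> x + (LBINT t. indicator {t..} x * v t * \<psi> x))"
    by (simp add: distrib_right)
  also have "\<dots> = c * (LBINT x. \<psi> x) + (LBINT x. (LBINT t. indicator {t..} x * v t * \<psi> x))"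
    using lborel_pair.integrable_fst[OF prod] \<psi> by (subst Bochner_Integration.integral_add) auto
  also have "\<dots> = (LBINT t. (LBINT x. indicator {t..} x * v t * \<psi> x))"
    using lborel_pair.Fubini_integral[OF prod] \<psi>_total by simp
  also have "\<dots> = (LBINT t. v t * (LBINT x. indicator {t..} x * \<psi> x))"
    by (simp add: mult_ac flip: integral_mult_right_zero)
  also have "\<dots> = (LBINT t. - (v t * \<phi> t))"
  proof (intro Bochner_Integration.integral_cong refl)
    show "v t * (LBINT x. indicator {t..} x * \<psi> x) = - (v t * \<phi> t)" for t
      using v0[of t] \<psi>_tail[of t] by (cases "t \<in> Omega_ref") auto
  qed
  also have "\<dots> = - (\<integral>t. v t * \<phi> t \<partial>lebesgue_on Omega_ref)"
    by (subst integral_lebesgue_on_eq_lborel) (auto simp: v0)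
  also have "(\<integral>t. v t * \<phi> t \<partial>lebesgue_on Omega_ref) = (\<integral>t. g t * \<phi> t \<partial>lebesgue_on Omega_ref)"
  proof (rule integral_cong_AE)
    show "AE x in lebesgue_on Omega_ref. v x * \<phi> x = g x * \<phi> x"
      using gv by eventually_elim simp
  qed (measurable; simp add: measurable_restrict_space1 measurable_completion)+
  finally show "(\<integral>x. a x * (deriv ^^ 1) \<phi> x \<partial>lebesgue_on Omega_ref)
      = (-1) ^ 1 * (\<integral>x. g x * \<phi> x \<partial>lebesgue_on Omega_ref)"
    by simp
qed

lemma indefinite_integral_in_H_space:
  assumes "g \<in> L2" and "\<And>x. x \<in> Omega_ref \<Longrightarrow> a x = c + (\<integral>t. g t \<partial>lebesgue_on {-1..x})"
  shows "a \<in> H_space 1" "continuous_on Omega_ref a" "has_weak_deriv 1 a g"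
proof -
  show cont: "continuous_on Omega_ref a"
  proof -
    have "continuous_on Omega_ref (\<lambda>x. c + (\<integral>t. g t \<partial>lebesgue_on {-1..x}))"
      using L2_integrable[OF assms(1)] unfolding Omega_ref_def
      by (intro continuous_intros indefinite_integral_continuous_real)
    then show ?thesis
      by (rule continuous_on_eq) (simp add: assms(2))
  qed
  show *: "has_weak_deriv 1 a g"
    using has_weak_deriv_indefinite_integral[OF L2_integrable[OF assms(1)] assms(2)] .
  have a: "a \<in> L2" using continuous_on_imp_L2[OF cont] .
  \<comment> \<open>\<open>H_space 1\<close> also asks for a weak derivative of order 0, for which
    \<open>a\<close> itself serves.\<close>
  moreover have "has_weak_deriv 0 a a" by (simp add: has_weak_deriv_def)
  moreover have "k = 0 \<or> k = 1" if "k \<le> 1" for k :: nat using that by auto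
  ultimately show "a \<in> H_space 1"
    using * assms(1) unfolding H_space_def by blast
qed

section \<open>Lagrange and edge polynomials\<close>

lemma poly_lagrange_node:
  assumes "inj_on \<xi> {..N}" "i \<le> N" "p \<le> N"
  shows "poly (lagrange N \<xi> i) (\<xi> p) = (if i = p then 1 else 0)"
proof (cases "i = p")
  case True
  have "(\<xi> p - \<xi> j) / (\<xi> p - \<xi> j) = 1" if "j \<in> {..N} - {p}" for j
    using inj_onD[OF assms(1), of p j] that assms by auto
  then show ?thesis
    using True by (simp add: lagrange_def poly_prod flip: diff_divide_distrib)
next
  case False
  then have "p \<in> {..N} - {i}" using assms by auto
  then have "poly (lagrange N \<xi> i) (\<xi> p) = 0"
    unfolding lagrange_def poly_prod by (intro prod_zero) (auto intro: bexI[of _ p])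
  with False show ?thesis by simp
qed

lemma degree_lagrange_le:
  assumes "i \<le> N"
  shows "degree (lagrange N \<xi> i) \<le> N"
proof -
  have "degree (lagrange N \<xi> i) \<le> (\<Sum>j\<in>{..N} - {i}. degree (smult (1 / (\<xi> i - \<xi> j)) [:- \<xi> j, 1:]))"
    unfolding lagrange_def by (rule degree_prod_sum_le[unfolded comp_def]) simp
  also have "\<dots> \<le> (\<Sum>j\<in>{..N} - {i}. 1)"
    by (intro sum_mono) simp
  also have "\<dots> = N" using assms by simp
  finally show ?thesis .
qed

text \<open>Both sides have degree at most \<open>N\<close> and agree at \<open>N + 1\<close>
  distinct nodes. Differentiated, this gives the linear relation among the
  \<open>pderiv (lagrange N \<xi> k)\<close> on which the commutation of the projections
  rests.\<close>

lemma sum_lagrange: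
  assumes "inj_on \<xi> {..N}"
  shows "(\<Sum>i\<le>N. lagrange N \<xi> i) = 1"
proof (rule poly_eqI_degree[of "\<xi> ` {..N}"])
  have card: "card (\<xi> ` {..N}) = Suc N"
    using card_image[OF assms] by simp
  fix x assume "x \<in> \<xi> ` {..N}"
  then obtain p where "p \<le> N" "x = \<xi> p" by auto
  then show "poly (\<Sum>i\<le>N. lagrange N \<xi> i) x = poly 1 x"
    by (simp add: poly_sum poly_lagrange_node[OF assms])
next
  show "degree (\<Sum>i\<le>N. lagrange N \<xi> i) < card (\<xi> ` {..N})" "degree 1 < card (\<xi> ` {..N})"
    using card_image[OF assms] by (auto intro: le_imp_less_Suc degree_sum_le degree_lagrange_le)
qed

lemma smult_sum_poly: "smult c (\<Sum>i\<in>A. f i) = (\<Sum>i\<in>A. smult c (f i))"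
  by (induction A rule: infinite_finite_induct) (auto simp: smult_add_right)

lemma pderiv_sum_poly: "pderiv (\<Sum>i\<in>A. f i) = (\<Sum>i\<in>A. pderiv (f i))"
  by (induction A rule: infinite_finite_induct) (auto simp: pderiv_add)

lemma sum_Suc_increments:
  fixes f :: "nat \<Rightarrow> real"
  shows "(\<Sum>j = 1..n. f j - f (j - 1)) = f n - f 0"
  by (induction n) auto

lemma sum_triangle_swap:
  fixes N :: nat
  shows "(\<Sum>j=1..N. \<Sum>i=j..N. f i j) = (\<Sum>i\<le>N. \<Sum>j=1..i. f i j)"
proof -
  have "(\<Sum>j=1..N. \<Sum>i=j..N. f i j) = (\<Sum>(j, i)\<in>(SIGMA j:{1..N}. {j..N}). f i j)"
    by (rule sum.Sigma) auto
  also have "\<dots> = (\<Sum>(i, j)\<in>(SIGMA i:{..N}. {1..i}). f i j)"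
    by (rule sum.reindex_bij_witness[of _ "\<lambda>(i, j). (j, i)" "\<lambda>(j, i). (i, j)"]) auto
  also have "\<dots> = (\<Sum>i\<le>N. \<Sum>j=1..i. f i j)"
    by (rule sum.Sigma[symmetric]) auto
  finally show ?thesis .
qed

lemma proj1_eq_pderiv_proj0:
  assumes inj: "inj_on \<xi> {..N}"
    and incr: "\<And>j. 1 \<le> j \<Longrightarrow> j \<le> N \<Longrightarrow> (\<integral>x. b x \<partial>lebesgue_on {\<xi> (j - 1)..\<xi> j}) = a (\<xi> j) - a (\<xi> (j - 1))"
  shows "proj1 N \<xi> b = pderiv (proj0 N \<xi> a)"
proof -
  define d where "d k = pderiv (lagrange N \<xi> k)" for k
  have sum0: "(\<Sum>k\<le>N. d k) = 0"
    using arg_cong[OF sum_lagrange[OF inj], of pderiv] by (simp add: pderiv_sum_poly d_def)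
  \<comment> \<open>As all the derivatives add up to 0, minus the sum below \<open>j\<close> equals
    the sum from \<open>j\<close> on. In this form the double sum runs over a triangle and the
    increments of \<open>a\<close> can be summed first.\<close>
  have edge: "edge N \<xi> j = (\<Sum>i=j..N. d i)" if "j \<le> N" for j
  proof -
    have "{..N} = {..<j} \<union> {j..N}" using that by auto
    then have "(\<Sum>k\<le>N. d k) = (\<Sum>k<j. d k) + (\<Sum>i=j..N. d i)"
      by (simp add: sum.union_disjoint ivl_disj_int)
    then show ?thesis
      using sum0 by (simp add: edge_def d_def[symmetric] neg_eq_iff_add_eq_0)
  qed
  have "proj1 N \<xi> b = (\<Sum>j=1..N. \<Sum>i=j..N. smult (a (\<xi> j) - a (\<xi> (j - 1))) (d i))"
    unfolding proj1_def by (intro sum.cong) (auto simp: incr edge smult_sum_poly simp del: One_nat_def)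
  also have "\<dots> = (\<Sum>i\<le>N. \<Sum>j=1..i. smult (a (\<xi> j) - a (\<xi> (j - 1))) (d i))"
    by (rule sum_triangle_swap)
  \<comment> \<open>The increments telescope. The value at the first node is a common factor of the
    sum of all \<open>d i\<close>, which is 0, so it disappears in the end.\<close>
  also have "\<dots> = (\<Sum>i\<le>N. smult (a (\<xi> i) - a (\<xi> 0)) (d i))"
    by (simp only: smult_sum[symmetric] sum_Suc_increments[of "\<lambda>j. a (\<xi> j)"])
  also have "\<dots> = (\<Sum>i\<le>N. smult (a (\<xi> i)) (d i)) - smult (a (\<xi> 0)) (\<Sum>i\<le>N. d i)"
    by (simp add: smult_diff_left sum_subtractf smult_sum_poly)
  also have "\<dots> = pderiv (proj0 N \<xi> a)"
    unfolding sum0 by (simp add: proj0_def pderiv_sum_poly pderiv_smult d_def)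
  finally show ?thesis .
qed

section \<open>Distinctness of the nodes and the uniform bound\<close>

lemma nodes_strict_mono:
  assumes "nodes N \<xi>" "i < j" "j \<le> N"
  shows "\<xi> i < \<xi> j"
  using assms(2,3)
proof (induction j)
  case (Suc j)
  then show ?case using assms(1) unfolding nodes_def
    by (cases "i = j") (auto intro: less_trans)
qed simp

lemma nodes_inj_on:
  assumes "nodes N \<xi>"
  shows "inj_on \<xi> {..N}"
proof (rule inj_onI)
  fix i j assume "i \<in> {..N}" "j \<in> {..N}" "\<xi> i = \<xi> j"
  then show "i = j"
    using nodes_strict_mono[OF assms, of i j] nodes_strict_mono[OF assms, of j i]
    by (cases i j rule: linorder_cases) auto
qed

theorem proposition30:
  fixes \<xi> :: "nat \<Rightarrow> nat \<Rightarrow> real" and h C\<^sub>0 :: "nat \<Rightarrow> real"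
  assumes "\<And>N. 1 \<le> N \<Longrightarrow> nodes N (\<xi> N)"
    and "\<And>N. 1 \<le> N \<Longrightarrow> 0 < h N"
    and "interpolation_estimate \<xi> h C\<^sub>0"
  shows "\<exists>C. \<forall>N\<ge>1. \<forall>b\<in>L2. L2_norm (poly (proj1 N (\<xi> N) b)) \<le> C * L2_norm b"
proof (intro exI allI impI ballI)
  fix N :: nat and b assume N: "1 \<le> N" and b: "b \<in> L2"
  note nodes = assms(1)[OF N]
  \<comment> \<open>The summand 0 is the constant \<open>c\<close> in
    \<open>indefinite_integral_in_H_space\<close>, which then applies to the defining equation
    directly.\<close>
  define a where "a x = 0 + (\<integral>t. b t \<partial>lebesgue_on {-1..x})" for x
  define P where "P = proj0 N (\<xi> N) a"
  let ?e = "\<lambda>x. a x - poly P x"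
  note a = indefinite_integral_in_H_space[OF b a_def]
  have proj1: "proj1 N (\<xi> N) b = pderiv P"
    unfolding P_def
  proof (rule proj1_eq_pderiv_proj0[OF nodes_inj_on[OF nodes]])
    fix j assume "1 \<le> j" "j \<le> N"
    then have "-1 \<le> \<xi> N (j - 1)" "\<xi> N (j - 1) \<le> \<xi> N j" "\<xi> N j \<le> 1"
      using nodes nodes_strict_mono[OF nodes, of "j - 1" j] by (auto simp: nodes_def Omega_ref_def)
    then show "(\<integral>x. b x \<partial>lebesgue_on {\<xi> N (j - 1)..\<xi> N j}) = a (\<xi> N j) - a (\<xi> N (j - 1))"
      unfolding a_def add_0 by (rule integral_lebesgue_on_Icc_split[OF L2_integrable[OF b]])
  qed
  have p: "poly (pderiv P) \<in> L2"
    by (intro continuous_on_imp_L2 continuous_intros)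
  have "has_weak_deriv 1 ?e (\<lambda>x. b x - poly (pderiv P) x)"
  \<comment> \<open>The interpolation error is itself a primitive, of \<open>b - P'\<close>; its
    constant is its value at -1, where \<open>a\<close> vanishes.\<close>
  proof (rule indefinite_integral_in_H_space(3)[OF L2_diff[OF b p]])
    fix x :: real assume x: "x \<in> Omega_ref"
    have "integrable (lebesgue_on {-1..x}) b"
      using integrable_on_Icc_subset_Omega_ref[OF L2_integrable[OF b]] x by (auto simp: Omega_ref_def)
    moreover have "integrable (lebesgue_on {-1..x}) (poly (pderiv P))"
      by (intro continuous_imp_integrable_real continuous_intros)
    moreover have "(\<integral>t. poly (pderiv P) t \<partial>lebesgue_on {-1..x}) = poly P x - poly P (-1)"
      using x by (intro integral_lebesgue_on_poly_pderiv) (simp add: Omega_ref_def)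
    ultimately show "?e x = - poly P (-1) + (\<integral>t. b t - poly (pderiv P) t \<partial>lebesgue_on {-1..x})"
      by (simp add: a_def)
  qed
  then have "L2_norm (\<lambda>x. b x - poly (pderiv P) x) = H_seminorm 1 ?e"
    by (simp add: H_seminorm_eq[OF L2_diff[OF b p]])
  also have "\<dots> \<le> H_norm ?e"
    unfolding H_norm_def by (rule real_le_rsqrt) simp
  \<comment> \<open>For \<open>m = 1\<close> the exponents \<open>min (N + 1) 1 - 1\<close> and
    \<open>1 - 1\<close> are both 0, so neither \<open>h N\<close> nor \<open>N\<close> is left in
    the bound.\<close>
  also have "\<dots> \<le> C\<^sub>0 1 * H_seminorm 1 a"
    using assms(3)[unfolded interpolation_estimate_def, rule_format, of N 1 a] N a(1,2)
    by (simp add: P_def)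
  also have "H_seminorm 1 a = L2_norm b"
    using H_seminorm_eq[OF b a(3)] .
  \<comment> \<open>Squaring preserves the inequality because its left side is a norm. The square of
    \<open>C\<^sub>0 1\<close> then enters the final constant, together with the two factors 2 of
    the squared triangle inequality.\<close>
  finally have "(L2_norm (\<lambda>x. b x - poly (pderiv P) x))\<^sup>2 \<le> (C\<^sub>0 1 * L2_norm b)\<^sup>2"
    by (intro power_mono) (auto simp: L2_norm_def)
  then have "(L2_norm (poly (pderiv P)))\<^sup>2 \<le> 2 * (L2_norm b)\<^sup>2 + 2 * (C\<^sub>0 1 * L2_norm b)\<^sup>2"
    using L2_norm_triangle_power2[OF b p] by simp
  also have "\<dots> = (sqrt (2 + 2 * (C\<^sub>0 1)\<^sup>2) * L2_norm b)\<^sup>2"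
    by (simp add: power_mult_distrib algebra_simps)
  finally show "L2_norm (poly (proj1 N (\<xi> N) b)) \<le> sqrt (2 + 2 * (C\<^sub>0 1)\<^sup>2) * L2_norm b"
    unfolding proj1 by (rule power2_le_imp_le) (auto simp: L2_norm_def intro!: mult_nonneg_nonneg)
qed

end
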